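(* Any real metric Lie algebra with no abelian irreducible factor has only a finite number of orthogonal bi-invariant complex structures.
   Context: All Lie algebras are finite-dimensional. A real metric Lie algebra is a real Lie algebra with a positive definite symmetric bilinear form $\langle\cdot,\cdot\rangle$. A factor is an ideal whose orthogonal complement is also an ideal; a non-zero metric Lie algebra is irreducible if its only factors are $0$ and itself. An orthogonal bi-invariant complex structure on a real metric Lie algebra $\mathfrak{g}$ is an $\mathbb{R}$-linear map $J:\mathfrak{g}\to\mathfrak{g}$ with $J^2=-\mathrm{Id}$, $J([X,Y])=[J(X),Y]$ and $\langle J(X),J(Y)\rangle=\langle X,Y\rangle$ for all $X,Y\in\mathfrak{g}$. *)

theory Defs
  imports "HOL-Analysis.Analysis"
begin

text \<open>
  The underlying metric vector space is a type of class \<open>real_inner\<close>, with the form given by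
  the class operation \<open>(\<bullet>)\<close>.  Finite dimension is an explicit assumption rather than
  the class \<open>euclidean_space\<close>, which would exclude the zero Lie algebra.
\<close>

locale metric_lie_algebra =
  fixes bracket :: "'a::real_inner \<Rightarrow> 'a \<Rightarrow> 'a"
  assumes finite_dimensional: "\<exists>B::'a set. finite B \<and> span B = UNIV"
    and bilinear_bracket: "bilinear bracket"
    and bracket_self: "bracket x x = 0"
    and jacobi: "bracket x (bracket y z) + bracket y (bracket z x) + bracket z (bracket x y) = 0"

text \<open>
  The notions below are relative to a subspace \<open>L\<close> closed under the bracket, seen as a
  metric Lie algebra with the restricted bracket and form.  This is needed because a factor of
  the Lie algebra is itself asked whether it is irreducible.
\<close>

definition lie_ideal :: "('a::real_inner \<Rightarrow> 'a \<Rightarrow> 'a) \<Rightarrow> 'a set \<Rightarrow> 'a set \<Rightarrow> bool" where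
  "lie_ideal bracket L I \<longleftrightarrow>
     subspace I \<and> I \<subseteq> L \<and> (\<forall>x\<in>L. \<forall>y\<in>I. bracket x y \<in> I)"

definition metric_factor :: "('a::real_inner \<Rightarrow> 'a \<Rightarrow> 'a) \<Rightarrow> 'a set \<Rightarrow> 'a set \<Rightarrow> bool" where
  "metric_factor bracket L I \<longleftrightarrow>
     lie_ideal bracket L I \<and> lie_ideal bracket L (L \<inter> I\<^sup>\<bottom>)"

definition metric_irreducible :: "('a::real_inner \<Rightarrow> 'a \<Rightarrow> 'a) \<Rightarrow> 'a set \<Rightarrow> bool" where
  "metric_irreducible bracket L \<longleftrightarrow>
     L \<noteq> {0} \<and> (\<forall>I. metric_factor bracket L I \<longrightarrow> I = {0} \<or> I = L)"

definition lie_abelian :: "('a::real_inner \<Rightarrow> 'a \<Rightarrow> 'a) \<Rightarrow> 'a set \<Rightarrow> bool" where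
  "lie_abelian bracket L \<longleftrightarrow> (\<forall>x\<in>L. \<forall>y\<in>L. bracket x y = 0)"

definition orthogonal_biinvariant_complex_structure ::
    "('a::real_inner \<Rightarrow> 'a \<Rightarrow> 'a) \<Rightarrow> ('a \<Rightarrow> 'a) \<Rightarrow> bool" where
  "orthogonal_biinvariant_complex_structure bracket J \<longleftrightarrow>
     linear J \<and> (\<forall>x. J (J x) = - x) \<and>
     (\<forall>x y. J (bracket x y) = bracket (J x) y) \<and>
     (\<forall>x y. J x \<bullet> J y = x \<bullet> y)"

end

theory Submission
  imports Defs
begin

text \<open>
  The hypothesis forces any two orthogonal bi-invariant complex structures \<open>J\<close> and \<open>K\<close> to commute.
  Bi-invariance gives \<open>J (K [x, y]) = [J x, K y] = K (J [x, y])\<close>, so \<open>C = J K - K J\<close> kills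
  every bracket and, as \<open>[C x, y] = C [x, y] = 0\<close>, takes central values.  Orthogonal complex
  structures are skew-adjoint, hence so is \<open>C\<close>, and its values are also orthogonal to every bracket.
  A non-zero central vector that is orthogonal to all brackets would span an abelian irreducible
  factor (\<open>abelian_irreducible_factor_span\<close>), so \<open>C = 0\<close>.

  Once one structure \<open>J\<^sub>0\<close> is fixed, the maps \<open>J\<^sub>0 \<circ> J\<close> are therefore pairwise commuting linear
  involutions.  On a finite-dimensional space such maps are simultaneously diagonalisable with
  eigenvalues \<open>1\<close> and \<open>-1\<close>, so there are only finitely many of them
  (\<open>finite_commuting_involutions_on\<close>), and \<open>J\<close> is recovered from \<open>J\<^sub>0 \<circ> J\<close>.
\<close>

section \<open>Commuting involutions\<close>

text \<open>
  Simultaneous diagonalisation, phrased as an induction on \<open>dim V\<close>.  If every member of \<open>F\<close> acts on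
  \<open>V\<close> as a sign, there are at most two restrictions.  Otherwise some member splits \<open>V\<close> into two
  proper eigenspaces; by commutation all of \<open>F\<close> preserves both, and a map on \<open>V\<close> is determined by its
  restrictions to them.
\<close>

lemma finite_commuting_involutions_on:
  fixes B V :: "'a::real_vector set"
  assumes B: "finite B" "span B = (UNIV :: 'a set)"
    and V: "subspace V"
    and lin: "\<And>S. S \<in> F \<Longrightarrow> linear S"
    and inv: "\<And>S x. S \<in> F \<Longrightarrow> x \<in> V \<Longrightarrow> S x \<in> V"
    and invol: "\<And>S x. S \<in> F \<Longrightarrow> x \<in> V \<Longrightarrow> S (S x) = x"
    and comm: "\<And>S T x. S \<in> F \<Longrightarrow> T \<in> F \<Longrightarrow> x \<in> V \<Longrightarrow> S (T x) = T (S x)"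
  shows "finite ((\<lambda>S. restrict S V) ` F)"
proof -
  obtain B' where B': "B' \<subseteq> B" "independent B'" "span B' = (UNIV :: 'a set)"
    using B maximal_independent_subset[of B]
    by (metis span_mono span_span top.extremum_uniqueI)
  interpret fd: finite_dimensional_vector_space "scaleR :: real \<Rightarrow> 'a \<Rightarrow> 'a" B'
    by unfold_locales
      (use B B' in \<open>auto simp: dependent_raw_def span_raw_def algebra_simps
          intro: finite_subset\<close>)
  have dim_less: "dim W < dim V" if "subspace W" "subspace V" "W \<subset> V" for W V :: "'a set"
    using fd.dim_psubset[of W V] that
    by (simp add: dim_raw_def[symmetric] span_raw_def[symmetric] span_eq_iff[THEN iffD2])
  show ?thesis
    using V inv invol comm
  proof (induction "dim V" arbitrary: V rule: less_induct)
    case (less V)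
    show ?case
    proof (cases "\<forall>S\<in>F. (\<forall>x\<in>V. S x = x) \<or> (\<forall>x\<in>V. S x = - x)")
      case True
      then have "(\<lambda>S. restrict S V) ` F \<subseteq> {restrict (\<lambda>x. x) V, restrict uminus V}"
        by (blast intro: restrict_ext)
      then show ?thesis
        by (rule finite_subset) simp
    next
      case False
      then obtain S where S: "S \<in> F" and nonscalar:
          "\<not> (\<forall>x\<in>V. S x = x)" "\<not> (\<forall>x\<in>V. S x = - x)"
        by blast
      define P where "P = {x \<in> V. S x = x}"
      define N where "N = {x \<in> V. S x = - x}"
      have "linear S"
        using lin S .
      have sub: "subspace P" "subspace N"
        using less.prems(1) \<open>linear S\<close> unfolding P_def N_def subspace_def
        by (auto simp: linear_add linear_scale linear_0)
      have "P \<subset> V" "N \<subset> V"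
        using nonscalar by (auto simp: P_def N_def)
      then have "dim P < dim V" "dim N < dim V"
        using dim_less sub less.prems(1) by blast+
      have "finite ((\<lambda>T. restrict T P) ` F)"
      proof (rule less.hyps[OF \<open>dim P < dim V\<close> sub(1)])
        show "T x \<in> P" if "T \<in> F" "x \<in> P" for T x
          using that less.prems(2) less.prems(4)[OF S, of T x] by (auto simp: P_def)
      qed (use less.prems in \<open>auto simp: P_def\<close>)
      moreover have "finite ((\<lambda>T. restrict T N) ` F)"
      proof (rule less.hyps[OF \<open>dim N < dim V\<close> sub(2)])
        show "T x \<in> N" if "T \<in> F" "x \<in> N" for T x
          using that less.prems(2) less.prems(4)[OF S, of T x] lin[of T]
          by (auto simp: N_def linear_neg)
      qed (use less.prems in \<open>auto simp: N_def\<close>)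
      \<comment> \<open>\<open>glue\<close> rebuilds a map on \<open>V\<close> from its two restrictions, using the projections
        \<open>(1 + S) / 2\<close> and \<open>(1 - S) / 2\<close> onto the eigenspaces.\<close>
      moreover define glue where "glue = (\<lambda>(p :: 'a \<Rightarrow> 'a, q).
        restrict (\<lambda>x. p ((1/2) *\<^sub>R (x + S x)) + q ((1/2) *\<^sub>R (x - S x))) V)"
      have "restrict T V = glue (restrict T P, restrict T N)" if "T \<in> F" for T
      proof
        fix x
        show "restrict T V x = glue (restrict T P, restrict T N) x"
        proof (cases "x \<in> V")
          case x: True
          have "S x \<in> V" and SS: "S (S x) = x"
            using less.prems(2,3) S x by auto
          have "(1/2) *\<^sub>R (x + S x) \<in> P"
            using less.prems(1) \<open>linear S\<close> x \<open>S x \<in> V\<close> SS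
            by (auto simp: P_def linear_add linear_scale add.commute
                intro!: subspace_scale subspace_add)
          moreover have "(1/2) *\<^sub>R (x - S x) \<in> N"
            using less.prems(1) \<open>linear S\<close> x \<open>S x \<in> V\<close> SS
            by (auto simp: N_def linear_diff linear_scale scaleR_diff_right
                intro!: subspace_scale subspace_diff)
          moreover have "(1/2) *\<^sub>R (x + S x) + (1/2) *\<^sub>R (x - S x) = x"
            by (simp add: scaleR_add_right[symmetric] scaleR_2[symmetric])
          then have "T x = T ((1/2) *\<^sub>R (x + S x)) + T ((1/2) *\<^sub>R (x - S x))"
            using lin[OF that] by (metis linear_add)
          ultimately show ?thesis
            using x by (simp add: glue_def)
        qed (simp add: glue_def)
      qed
      then have "(\<lambda>T. restrict T V) ` F
          \<subseteq> glue ` ((\<lambda>T. restrict T P) ` F \<times> (\<lambda>T. restrict T N) ` F)"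
        by blast
      ultimately show ?thesis
        by (meson finite_SigmaI finite_imageI finite_subset)
    qed
  qed
qed

section \<open>Metric Lie algebras\<close>

text \<open>
  Centrality of \<open>v\<close> makes its span an ideal, orthogonality to the brackets makes the complement an
  ideal, and a line is irreducible because it has no other subspaces than \<open>0\<close> and itself.
\<close>

lemma abelian_irreducible_factor_span:
  fixes bracket :: "'a::real_inner \<Rightarrow> 'a \<Rightarrow> 'a"
  assumes bil: "bilinear bracket"
    and central: "\<And>y. bracket y v = 0"
    and orth: "\<And>x y. v \<bullet> bracket x y = 0"
    and "v \<noteq> 0"
  shows "metric_factor bracket UNIV (span {v})"
    and "metric_irreducible bracket (span {v})"
    and "lie_abelian bracket (span {v})"
proof -
  have zero: "bracket x y = 0" if "y \<in> span {v}" for x y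
    using that central by (auto simp: span_singleton bilinear_rmul[OF bil])
  have sub: "subspace (span {v})"
    by (rule subspace_span)
  show "metric_factor bracket UNIV (span {v})"
    unfolding metric_factor_def lie_ideal_def
  proof (intro conjI ballI)
    show "subspace (UNIV \<inter> (span {v})\<^sup>\<bottom>)"
      by (simp add: subspace_orthogonal_comp)
  qed (use zero sub span_zero orth in
      \<open>auto simp: orthogonal_comp_def orthogonal_def span_singleton\<close>)
  show "lie_abelian bracket (span {v})"
    using zero by (auto simp: lie_abelian_def)
  have "I = {0} \<or> I = span {v}" if "subspace I" "I \<subseteq> span {v}" for I
  proof (cases "I = {0}")
    case False
    then obtain w where "w \<in> I" "w \<noteq> 0"
      using subspace_0[OF \<open>subspace I\<close>] by blast
    then obtain c where "w = c *\<^sub>R v"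
      using \<open>I \<subseteq> span {v}\<close> by (auto simp: span_singleton)
    then have "v = inverse c *\<^sub>R w"
      using \<open>w \<noteq> 0\<close> by auto
    then have "v \<in> I"
      using \<open>w \<in> I\<close> \<open>subspace I\<close> by (metis subspace_scale)
    then show ?thesis
      using that span_minimal[of "{v}" I] by auto
  qed simp
  moreover have "span {v} \<noteq> {0}"
    using \<open>v \<noteq> 0\<close> span_base[of v "{v}"] by auto
  ultimately show "metric_irreducible bracket (span {v})"
    by (auto simp: metric_irreducible_def metric_factor_def lie_ideal_def)
qed

context metric_lie_algebra
begin

lemma bracket_swap: "bracket x y = - bracket y x"
proof -
  have "bracket (x + y) (x + y) = bracket x x + bracket x y + (bracket y x + bracket y y)"
    by (simp only: bilinear_ladd[OF bilinear_bracket] bilinear_radd[OF bilinear_bracket] add_ac)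
  then show ?thesis
    by (simp add: bracket_self eq_neg_iff_add_eq_0)
qed

lemma complex_structure_bracket_right:
  assumes "orthogonal_biinvariant_complex_structure bracket J"
  shows "bracket x (J y) = J (bracket x y)"
proof -
  have J: "linear J" "\<And>x y. J (bracket x y) = bracket (J x) y"
    using assms by (auto simp: orthogonal_biinvariant_complex_structure_def)
  have "bracket x (J y) = - J (bracket y x)"
    using J(2) bracket_swap by metis
  also have "\<dots> = J (bracket x y)"
    using linear_neg[OF J(1)] bracket_swap by metis
  finally show ?thesis .
qed

end

lemma complex_structure_skew:
  assumes "orthogonal_biinvariant_complex_structure bracket J"
  shows "J x \<bullet> y = - (x \<bullet> J y)"
proof -
  have "J x \<bullet> y = J (J x) \<bullet> J y"
    using assms unfolding orthogonal_biinvariant_complex_structure_def by metis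
  also have "\<dots> = - (x \<bullet> J y)"
    using assms by (simp add: orthogonal_biinvariant_complex_structure_def)
  finally show ?thesis .
qed

text \<open>
  A non-zero value of the commutator of \<open>J\<close> and \<open>K\<close> would be central and orthogonal to all brackets,
  and so would span an abelian irreducible factor.
\<close>

lemma (in metric_lie_algebra) complex_structures_commute:
  assumes no_abelian: "\<not> (\<exists>F. metric_factor bracket UNIV F \<and> metric_irreducible bracket F
      \<and> lie_abelian bracket F)"
    and J: "orthogonal_biinvariant_complex_structure bracket J"
    and K: "orthogonal_biinvariant_complex_structure bracket K"
  shows "J (K x) = K (J x)"
proof -
  have left: "\<And>x y. bracket (J x) y = J (bracket x y)" "\<And>x y. bracket (K x) y = K (bracket x y)"
    using J K by (auto simp: orthogonal_biinvariant_complex_structure_def)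
  have comm: "J (K (bracket a b)) = K (J (bracket a b))" for a b
    by (metis left complex_structure_bracket_right[OF K])
  define v where "v = J (K x) - K (J x)"
  have "bracket v y = 0" for y
    by (simp add: v_def bilinear_lsub[OF bilinear_bracket] left comm)
  then have "bracket y v = 0" for y
    by (metis bracket_swap neg_equal_0_iff_equal)
  moreover have "v \<bullet> bracket a b = 0" for a b
    by (simp add: v_def inner_diff_left complex_structure_skew[OF J] complex_structure_skew[OF K]
        comm)
  ultimately have "v = 0"
    using abelian_irreducible_factor_span[OF bilinear_bracket, of v] no_abelian by blast
  then show ?thesis
    by (simp add: v_def)
qed

section \<open>Finiteness\<close>

theorem corollary4p9:
  fixes bracket :: "'a::real_inner \<Rightarrow> 'a \<Rightarrow> 'a"
  assumes "metric_lie_algebra bracket"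
    and "\<not> (\<exists>F. metric_factor bracket UNIV F \<and> metric_irreducible bracket F
                \<and> lie_abelian bracket F)"
  shows "finite {J. orthogonal_biinvariant_complex_structure bracket J}"
proof -
  interpret metric_lie_algebra bracket
    by fact
  let ?\<J> = "{J. orthogonal_biinvariant_complex_structure bracket J}"
  have lin: "linear J" and sq: "J (J x) = - x" if "J \<in> ?\<J>" for J x
    using that by (auto simp: orthogonal_biinvariant_complex_structure_def)
  have comm: "J (K x) = K (J x)" if "J \<in> ?\<J>" "K \<in> ?\<J>" for J K x
    using complex_structures_commute[OF assms(2)] that by blast
  show ?thesis
  proof (cases "?\<J> = {}")
    case False
    then obtain J\<^sub>0 where J\<^sub>0: "J\<^sub>0 \<in> ?\<J>"
      by blast
    obtain B :: "'a set" where B: "finite B" "span B = UNIV"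
      using finite_dimensional by blast
    have "finite ((\<lambda>S. restrict S UNIV) ` ((\<lambda>J. J\<^sub>0 \<circ> J) ` ?\<J>))"
    proof (rule finite_commuting_involutions_on[OF B subspace_UNIV])
      show "linear S" if "S \<in> (\<lambda>J. J\<^sub>0 \<circ> J) ` ?\<J>" for S
        using that lin J\<^sub>0 by (auto intro: linear_compose)
      show "S (S x) = x" if S: "S \<in> (\<lambda>J. J\<^sub>0 \<circ> J) ` ?\<J>" for S x
      proof -
        obtain J where "J \<in> ?\<J>" "S = J\<^sub>0 \<circ> J"
          using S by blast
        then show ?thesis
          using comm[OF J\<^sub>0 \<open>J \<in> ?\<J>\<close>] sq[OF J\<^sub>0] sq[OF \<open>J \<in> ?\<J>\<close>] linear_neg[OF lin[OF J\<^sub>0]]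
          by (simp del: mem_Collect_eq)
      qed
      show "S (T x) = T (S x)"
        if S: "S \<in> (\<lambda>J. J\<^sub>0 \<circ> J) ` ?\<J>" and T: "T \<in> (\<lambda>J. J\<^sub>0 \<circ> J) ` ?\<J>" for S T x
      proof -
        obtain J K where "J \<in> ?\<J>" "S = J\<^sub>0 \<circ> J" "K \<in> ?\<J>" "T = J\<^sub>0 \<circ> K"
          using S T by blast
        then show ?thesis
          using comm[OF J\<^sub>0 \<open>J \<in> ?\<J>\<close>] comm[OF J\<^sub>0 \<open>K \<in> ?\<J>\<close>] comm[OF \<open>J \<in> ?\<J>\<close> \<open>K \<in> ?\<J>\<close>]
          by (simp del: mem_Collect_eq)
      qed
    qed simp
    then have "finite ((\<lambda>J. J\<^sub>0 \<circ> J) ` ?\<J>)"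
      by (simp add: restrict_def)
    moreover have "inj_on (\<lambda>J. J\<^sub>0 \<circ> J) ?\<J>"
    proof (rule inj_onI, rule ext)
      fix J K x
      assume "J\<^sub>0 \<circ> J = J\<^sub>0 \<circ> K"
      then have "J\<^sub>0 (J\<^sub>0 (J x)) = J\<^sub>0 (J\<^sub>0 (K x))"
        by (metis comp_apply)
      then show "J x = K x"
        using sq[OF J\<^sub>0] by simp
    qed
    ultimately show ?thesis
      by (rule finite_imageD)
  qed simp
qed

end
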